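(* Let $p>2$ be a prime and let $n$ be a positive integer. Let $a$ and $b$ be even integers with $0\le a<b\le p-1$. Let $s,t$ be positive integers with $n\le s\le t$, and let $i$ be an arbitrary non-negative integer. Then, in $\mathbb{Z}$, $$\sum_{r=0}^{2^n-1}(-1)^r\binom{k_r^{(s)}/2}{i}\binom{\alpha^{(t)}(a,b)-i}{k_r^{(s)}/2}\equiv 0 \pmod{p^n},$$ where $k_r^{(s)}$ and $\alpha^{(t)}(a,b)$ are the integers defined in the context.
   Context: For a non-negative integer $r$ with binary expansion $r=\sum_{j\ge 0} r_j2^j$, $r_j\in\{0,1\}$, set $k_r:=\sum_{j=0}^{\infty}\big((b-a)r_j+a\big)p^j\in\mathbb{Z}_p$, and let $k_r^{(s)}:=\sum_{j=0}^{s-1}\big((b-a)r_j+a\big)p^j\in\mathbb{Z}$ be its truncation to the first $s$ $p$-adic digits. Since $a,b$ are even, $k_r^{(s)}/2$ is a non-negative integer. Set $\alpha(a,b):=\sum_{j=0}^{\infty}\frac{a+b}{2}p^j=\frac{a+b}{2(1-p)}\in\mathbb{Z}_p$ and $\alpha^{(t)}(a,b):=\sum_{j=0}^{t-1}\frac{a+b}{2}p^j\in\mathbb{Z}$. Binomial coefficients are generalized: $\binom{x}{k}=\frac{x(x-1)\cdots(x-k+1)}{k!}$ for $k\ge 0$, $\binom{x}{0}=1$. *)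

theory Defs
  imports "HOL-Number_Theory.Number_Theory"
begin

text \<open>
  The library constant \<open>gchoose\<close> is defined for integers as well, but theories based on
  \<open>Main\<close> may only apply it in fields of characteristic zero. \<open>zchoose\<close> is the same function
  on the integers; \<open>of_int_zchoose\<close> below shows that the division by \<open>fact k\<close> is exact.
\<close>

definition zchoose :: "int \<Rightarrow> nat \<Rightarrow> int"  (infix \<open>zchoose\<close> 64) where
  "x zchoose k = (\<Prod>i = 0..<k. x - int i) div fact k"

lemma of_int_zchoose: "of_int (x zchoose k) = (of_int x :: 'a::field_char_0) gchoose k"
  unfolding zchoose_def gbinomial_prod_rev [where 'a = int, symmetric]
  by (rule of_int_gbinomial)

text \<open>
  \<open>k_trunc p a b s r\<close> is the truncation $k_r^{(s)}$ of the $p$-adic integer $k_r$ whose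
  $j$-th digit is $b$ if the $j$-th binary digit of $r$ is $1$, and $a$ otherwise;
  \<open>alpha_trunc p a b t\<close> is $\alpha^{(t)}(a,b)$. For even \<open>a\<close> and \<open>b\<close> the division by two
  in \<open>alpha_trunc\<close> is exact.
\<close>

definition k_trunc :: "nat \<Rightarrow> int \<Rightarrow> int \<Rightarrow> nat \<Rightarrow> nat \<Rightarrow> int" where
  "k_trunc p a b s r = (\<Sum>j<s. ((b - a) * of_bool (bit r j) + a) * int p ^ j)"

definition alpha_trunc :: "nat \<Rightarrow> int \<Rightarrow> int \<Rightarrow> nat \<Rightarrow> int" where
  "alpha_trunc p a b t = (\<Sum>j<t. ((a + b) div 2) * int p ^ j)"

end

theory Submission
  imports Defs
begin

text \<open>
  Write \<open>m\<close> for $k_r^{(s)}/2$ and \<open>A\<close> for $\alpha^{(t)}$. By Vandermonde,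
  $\binom{m}{i}\binom{A-i}{m} = \sum_k \binom{k}{i}\binom{m}{k}\binom{A-m}{k}$, so it suffices to
  treat $f_k(x,y) = \binom{x}{k}\binom{y}{k}$ at $(m, A-m)$. The lowest $n$ digits of these two
  numbers are \<open>a/2\<close> and \<open>b/2\<close> in complementary positions, and the sign $(-1)^r$ only sees the
  lowest digit. For $0 \<le> c < p$ one has
  $u\binom{px+a}{pk+c} = \binom{x}{k} S(px)$ with an integer polynomial \<open>S\<close> and \<open>u\<close> prime to \<open>p\<close>.
  Hence, if \<open>W\<close> is an antisymmetric integer polynomial, summing \<open>f\<^sub>k W\<close> over the two choices of
  the lowest digit gives, up to a factor prime to \<open>p\<close>, the value of
  $f_{k'}(x,y)\,(Z(px,py) - Z(py,px))$ at the remaining digits. The constant term of \<open>Z\<close> cancels,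
  so this is \<open>p\<close> times a function of the same shape: every digit yields one factor \<open>p\<close>. The
  alternating sum over the lowest digit plays the same role for \<open>W = 1\<close>.
\<close>

section \<open>Integer polynomials in two variables\<close>

text \<open>Polynomials are kept as functions, so that composition and exchange of variables need no
  coefficient arithmetic. A polynomial \<open>S\<close> in one variable enters as
  \<open>\<lambda>x y. S x\<close>.\<close>

inductive int_poly2 :: "(int \<Rightarrow> int \<Rightarrow> int) \<Rightarrow> bool" where
  const: "int_poly2 (\<lambda>x y. c)"
| fst: "int_poly2 (\<lambda>x y. x)"
| snd: "int_poly2 (\<lambda>x y. y)"
| add: "int_poly2 F \<Longrightarrow> int_poly2 G \<Longrightarrow> int_poly2 (\<lambda>x y. F x y + G x y)"
| mult: "int_poly2 F \<Longrightarrow> int_poly2 G \<Longrightarrow> int_poly2 (\<lambda>x y. F x y * G x y)"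

lemma int_poly2_compose:
  assumes "int_poly2 F" "int_poly2 G" "int_poly2 H"
  shows "int_poly2 (\<lambda>x y. F (G x y) (H x y))"
  using assms by (induction rule: int_poly2.induct) (auto intro: int_poly2.intros)

lemma int_poly2_swap: "int_poly2 F \<Longrightarrow> int_poly2 (\<lambda>x y. F y x)"
  using int_poly2_compose[OF _ int_poly2.snd int_poly2.fst] .

lemma int_poly2_diff:
  assumes "int_poly2 F" "int_poly2 G"
  shows "int_poly2 (\<lambda>x y. F x y - G x y)"
  using int_poly2.add[OF assms(1) int_poly2.mult[OF int_poly2.const[of "-1"] assms(2)]] by simp

lemma int_poly2_prod:
  assumes "\<And>j. j \<in> I \<Longrightarrow> int_poly2 (F j)"
  shows "int_poly2 (\<lambda>x y. \<Prod>j\<in>I. F j x y)"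
  using assms
  by (induction I rule: infinite_finite_induct) (auto intro: int_poly2.intros)

text \<open>Every nonconstant monomial picks up a factor \<open>q\<close>. The quotient
  \<open>G\<close> is again an integer polynomial, not merely an integer-valued function, so the
  digit step can be iterated.\<close>

lemma int_poly2_scaled:
  assumes "int_poly2 F"
  obtains G where "int_poly2 G" "\<And>x y. F (q * x) (q * y) = F 0 0 + q * G x y"
proof -
  have "\<exists>G. int_poly2 G \<and> (\<forall>x y. F (q * x) (q * y) = F 0 0 + q * G x y)"
    using assms
  proof (induction rule: int_poly2.induct)
    case (const c)
    then show ?case by (intro exI[of _ "\<lambda>x y. 0"]) (auto intro: int_poly2.intros)
  next
    case fst
    then show ?case by (intro exI[of _ "\<lambda>x y. x"]) (auto intro: int_poly2.intros)
  next
    case snd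
    then show ?case by (intro exI[of _ "\<lambda>x y. y"]) (auto intro: int_poly2.intros)
  next
    case (add F G)
    then obtain F' G' where "int_poly2 F'" "\<And>x y. F (q * x) (q * y) = F 0 0 + q * F' x y"
      "int_poly2 G'" "\<And>x y. G (q * x) (q * y) = G 0 0 + q * G' x y"
      by blast
    then show ?case
      by (intro exI[of _ "\<lambda>x y. F' x y + G' x y"] conjI int_poly2.add)
        (simp_all add: distrib_left)
  next
    case (mult F G)
    then obtain F' G' where "int_poly2 F'" "\<And>x y. F (q * x) (q * y) = F 0 0 + q * F' x y"
      "int_poly2 G'" "\<And>x y. G (q * x) (q * y) = G 0 0 + q * G' x y"
      by blast
    \<comment> \<open>The witness is the expansion of
      \<open>(F 0 0 + q * F' x y) * (G 0 0 + q * G' x y)\<close> without its constant term, divided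
      by \<open>q\<close>.\<close>
    then show ?case
      by (intro exI[of _ "\<lambda>x y. F' x y * G 0 0 + (F 0 0 * G' x y + q * (F' x y * G' x y))"]
          conjI int_poly2.add int_poly2.mult int_poly2.const) (simp_all add: algebra_simps)
  qed
  then show ?thesis using that by blast
qed

section \<open>Binomial coefficients and the lowest base-p digit\<close>

lemma int_binomial_Suc: "int (z choose Suc K) * int (Suc K) = int (z choose K) * (int z - int K)"
proof (cases "K \<le> z")
  case True
  have "(z choose Suc K) * Suc K = (z choose K) * (z - K)"
    using binomial_absorb_comp[of z K] Suc_times_binomial_eq[of "z - 1" K] True
    by (cases z) (auto simp: algebra_simps)
  then have "int ((z choose Suc K) * Suc K) = int ((z choose K) * (z - K))"
    by presburger
  then show ?thesis using True by (simp only: of_nat_mult of_nat_diff)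
qed (simp add: binomial_eq_0)

lemma int_binomial_add:
  "int (z choose (K + m)) * (\<Prod>l<m. int K + int l + 1)
     = int (z choose K) * (\<Prod>l<m. int z - int K - int l)"
proof (induction m)
  case (Suc m)
  have "int (z choose (K + Suc m)) * (\<Prod>l<Suc m. int K + int l + 1)
      = (int (z choose Suc (K + m)) * int (Suc (K + m))) * (\<Prod>l<m. int K + int l + 1)"
    by (simp add: algebra_simps)
  also have "\<dots> = (int (z choose (K + m)) * (\<Prod>l<m. int K + int l + 1)) * (int z - int (K + m))"
    unfolding int_binomial_Suc by (simp only: mult_ac)
  also have "\<dots> = int (z choose K) * (\<Prod>l<Suc m. int z - int K - int l)"
    by (simp only: Suc.IH) (simp add: algebra_simps)
  finally show ?case .
qed simp

text \<open>Modulo \<open>p\<close> the factors are \<open>1, ..., m\<close> with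
  \<open>m < p\<close>, so none of them vanishes.\<close>

lemma not_dvd_prod_consecutive:
  assumes "prime p" "m < p"
  shows "\<not> int p dvd (\<Prod>l<m. int (p * k) + int l + 1)"
proof
  assume "int p dvd (\<Prod>l<m. int (p * k) + int l + 1)"
  then obtain l where "l < m" "int p dvd int (p * k) + int l + 1"
    using assms(1) by (auto simp: prime_dvd_prod_iff)
  then have "int p dvd int (Suc l)"
    by (metis ab_semigroup_add_class.add_ac(1) add.commute dvd_add_right_iff dvd_triv_left
        of_nat_Suc of_nat_mult)
  then have "p dvd Suc l" by presburger
  with \<open>l < m\<close> assms(2) show False by (auto dest: dvd_imp_le)
qed

text \<open>Passing from \<open>k\<close> to \<open>Suc k\<close> adds \<open>p\<close> numerator
  and \<open>p\<close> denominator factors. Exactly one of each is a visible multiple of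
  \<open>p\<close>: \<open>p * (x - k)\<close> and \<open>p * Suc k\<close>. Their quotient turns
  \<open>x choose k\<close> into \<open>x choose Suc k\<close>; the other denominators are prime to
  \<open>p\<close> and go into \<open>u\<close>, the other numerators are polynomial in
  \<open>p * x\<close> and go into \<open>S\<close>.\<close>

lemma binomial_mult_prime_block:
  assumes "prime p" "a < p"
  obtains u S where "\<not> int p dvd u" "int_poly2 (\<lambda>x y. S x)"
    "\<And>x. int ((p * x + a) choose (p * k)) * u = int (x choose k) * S (int p * int x)"
proof -
  have "\<exists>u S. \<not> int p dvd u \<and> int_poly2 (\<lambda>x y. S x) \<and>
    (\<forall>x. int ((p * x + a) choose (p * k)) * u = int (x choose k) * S (int p * int x))"
  proof (induction k)
    case 0
    have "\<not> int p dvd 1" using assms(1) by (simp add: prime_nat_iff)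
    then show ?case
      by (intro exI[of _ 1] exI[of _ "\<lambda>x. 1"]) (auto intro: int_poly2.intros)
  next
    case (Suc k)
    then obtain u S where u: "\<not> int p dvd u" and S: "int_poly2 (\<lambda>x y. S x)"
      and eq: "\<And>x. int ((p * x + a) choose (p * k)) * u = int (x choose k) * S (int p * int x)"
      by blast
    \<comment> \<open>\<open>v\<close> omits the last denominator, \<open>p * Suc k\<close>;
      \<open>R\<close> omits the numerator at \<open>l = a\<close>, which is
      \<open>p * (x - k)\<close>.\<close>
    define v where "v = (\<Prod>l<p - 1. int (p * k) + int l + 1)"
    define R where "R = (\<lambda>X. \<Prod>l\<in>{..<p} - {a}. X + (int a - int (p * k) - int l))"
    have p0: "p > 0" using assms(2) by simp
    have R: "int_poly2 (\<lambda>x y. R x)"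
      unfolding R_def by (intro int_poly2_prod int_poly2.intros)
    have v: "(\<Prod>l<p. int (p * k) + int l + 1) = v * (int p * int (Suc k))"
    proof -
      obtain q where q: "p = Suc q" using p0 by (cases p) auto
      show ?thesis unfolding v_def q by (simp add: algebra_simps)
    qed
    have R': "(\<Prod>l<p. int (p * x + a) - int (p * k) - int l)
        = int p * (int x - int k) * R (int p * int x)" for x
    proof -
      have "(\<Prod>l<p. int (p * x + a) - int (p * k) - int l)
          = (int (p * x + a) - int (p * k) - int a)
            * (\<Prod>l\<in>{..<p} - {a}. int (p * x + a) - int (p * k) - int l)"
        using assms(2) by (subst prod.remove[of _ a]) auto
      then show ?thesis by (simp add: R_def algebra_simps)
    qed
    have "int ((p * x + a) choose (p * Suc k)) * (v * u)
        = int (x choose Suc k) * (S (int p * int x) * R (int p * int x))" for x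
    proof -
      have "int ((p * x + a) choose (p * Suc k)) * (v * u) * (int p * int (Suc k))
          = int ((p * x + a) choose (p * k + p)) * (\<Prod>l<p. int (p * k) + int l + 1) * u"
        unfolding v mult_Suc_right add.commute[of p "p * k"] by (simp only: mult_ac)
      also have "\<dots> = (int ((p * x + a) choose (p * k)) * u)
          * (int p * (int x - int k) * R (int p * int x))"
        unfolding int_binomial_add R' by (simp only: mult_ac)
      also have "\<dots> = (int (x choose k) * (int x - int k))
          * (int p * S (int p * int x) * R (int p * int x))"
        unfolding eq by (simp only: mult_ac)
      also have "\<dots> = int (x choose Suc k) * (S (int p * int x) * R (int p * int x))
          * (int p * int (Suc k))"
        unfolding int_binomial_Suc[symmetric] by (simp only: mult_ac)
      finally show ?thesis using p0 by (subst (asm) mult_right_cancel) auto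
    qed
    moreover have "\<not> int p dvd v * u"
      using u not_dvd_prod_consecutive[of p "p - 1" k] assms(1) p0
      unfolding v_def by (subst prime_dvd_mult_iff) auto
    ultimately show ?case
      using int_poly2.mult[OF S R] by (intro exI[of _ "v * u"] exI[of _ "\<lambda>X. S X * R X"]) auto
  qed
  then show ?thesis using that by blast
qed

text \<open>The \<open>K mod p\<close> factors beyond the full blocks have denominators prime to
  \<open>p\<close>, so they only enlarge \<open>u\<close> and \<open>S\<close>. Both are independent
  of \<open>x\<close>, which later allows one \<open>u\<close> to clear a whole sum.\<close>

lemma binomial_lowest_digit:
  assumes "prime p" "a < p"
  obtains u S where "\<not> int p dvd u" "int_poly2 (\<lambda>x y. S x)"
    "\<And>x. int ((p * x + a) choose K) * u = int (x choose (K div p)) * S (int p * int x)"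
proof -
  define k c where "k = K div p" and "c = K mod p"
  obtain u S where u: "\<not> int p dvd u" and S: "int_poly2 (\<lambda>x y. S x)"
    and eq: "\<And>x. int ((p * x + a) choose (p * k)) * u = int (x choose k) * S (int p * int x)"
    by (rule binomial_mult_prime_block[OF assms]) blast
  define v where "v = (\<Prod>l<c. int (p * k) + int l + 1)"
  define R where "R = (\<lambda>X. \<Prod>l<c. X + (int a - int (p * k) - int l))"
  have K: "K = p * k + c" by (simp add: k_def c_def)
  have "c < p" using assms(2) by (simp add: c_def)
  then have "\<not> int p dvd v * u"
    using u not_dvd_prod_consecutive[of p c k] assms(1)
    unfolding v_def by (subst prime_dvd_mult_iff) auto
  moreover have "int_poly2 (\<lambda>x y. S x * R x)"
    unfolding R_def by (intro int_poly2_prod int_poly2.intros S)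
  moreover have "int ((p * x + a) choose K) * (v * u)
      = int (x choose (K div p)) * (S (int p * int x) * R (int p * int x))" for x
  proof -
    have "int ((p * x + a) choose K) * (v * u)
        = int ((p * x + a) choose (p * k)) * (\<Prod>l<c. int (p * x + a) - int (p * k) - int l) * u"
      unfolding K v_def by (simp only: int_binomial_add mult.assoc[symmetric])
    also have "\<dots> = (int ((p * x + a) choose (p * k)) * u) * R (int p * int x)"
      by (simp add: R_def algebra_simps)
    finally show ?thesis unfolding eq k_def[symmetric] by (simp only: mult_ac)
  qed
  ultimately show ?thesis by (rule that)
qed

section \<open>Summation over the two choices of the lowest digit\<close>

text \<open>The sign \<epsilon> treats two cases at once: \<open>1\<close> for an antisymmetric
  weight \<open>W\<close>, \<open>-1\<close> for a symmetric one. In both, the second summand is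
  minus the first with \<open>x\<close> and \<open>y\<close> exchanged, up to the common unit, so
  the new weight \<open>W'\<close> is antisymmetric.\<close>

lemma binomial_pair_sum_lowest_digit:
  fixes \<epsilon> :: int
  assumes p: "prime p" and ab: "a < p" "b < p" and W: "int_poly2 W"
    and sym: "\<And>x y. W y x = - \<epsilon> * W x y" and \<epsilon>: "\<epsilon> * \<epsilon> = 1"
  shows "\<exists>u W'. \<not> int p dvd u \<and> int_poly2 W' \<and> (\<forall>x y. W' y x = - W' x y) \<and>
    (\<forall>x y. u * (int ((p * x + a) choose K) * int ((p * y + b) choose K)
                 * W (int (p * x + a)) (int (p * y + b))
              + \<epsilon> * (int ((p * x + b) choose K) * int ((p * y + a) choose K)
                 * W (int (p * x + b)) (int (p * y + a))))
       = int p * (int (x choose (K div p)) * int (y choose (K div p)) * W' (int x) (int y)))"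
proof -
  obtain u S where u: "\<not> int p dvd u" and S: "int_poly2 (\<lambda>x y. S x)"
    and Seq: "\<And>x. int ((p * x + a) choose K) * u = int (x choose (K div p)) * S (int p * int x)"
    by (rule binomial_lowest_digit[OF p ab(1)]) blast
  obtain v R where v: "\<not> int p dvd v" and R: "int_poly2 (\<lambda>x y. R x)"
    and Req: "\<And>x. int ((p * x + b) choose K) * v = int (x choose (K div p)) * R (int p * int x)"
    by (rule binomial_lowest_digit[OF p ab(2)]) blast
  \<comment> \<open>\<open>X\<close> and \<open>Y\<close> stand for \<open>p * x\<close> and
    \<open>p * y\<close>; \<open>Z\<close> collects everything except the binomials with lower index
    \<open>K div p\<close>.\<close>
  define Z where "Z = (\<lambda>X Y. S X * R Y * W (X + int a) (Y + int b))"
  have "int_poly2 Z"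
    unfolding Z_def
    by (intro int_poly2.mult S int_poly2_swap[OF R] int_poly2_compose[OF W] int_poly2.intros)
  then obtain G where G: "int_poly2 G" "\<And>x y. Z (int p * x) (int p * y) = Z 0 0 + int p * G x y"
    by (rule int_poly2_scaled[where q = "int p"]) blast
  define W' where "W' = (\<lambda>x y. G x y - G y x)"
  have "\<not> int p dvd u * v"
    using u v p by (subst prime_dvd_mult_iff) auto
  moreover have "int_poly2 W'"
    unfolding W'_def by (rule int_poly2_diff[OF G(1) int_poly2_swap[OF G(1)]])
  moreover have "W' y x = - W' x y" for x y
    by (simp add: W'_def)
  moreover have "(u * v) * (int ((p * x + a) choose K) * int ((p * y + b) choose K)
                 * W (int (p * x + a)) (int (p * y + b))
              + \<epsilon> * (int ((p * x + b) choose K) * int ((p * y + a) choose K)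
                 * W (int (p * x + b)) (int (p * y + a))))
       = int p * (int (x choose (K div p)) * int (y choose (K div p)) * W' (int x) (int y))"
    (is "_ * (?Ax * ?By * ?W1 + \<epsilon> * (?Bx * ?Ay * ?W2)) = _ * (?x * ?y * _)") for x y
  proof -
    have W2: "\<epsilon> * ?W2 = - W (int (p * y + a)) (int (p * x + b))"
      using sym[of "int (p * y + a)" "int (p * x + b)"] \<epsilon> by (simp add: mult.assoc[symmetric])
    have "(u * v) * (?Ax * ?By * ?W1 + \<epsilon> * (?Bx * ?Ay * ?W2))
        = (?Ax * u) * (?By * v) * ?W1 + (?Ay * u) * (?Bx * v) * (\<epsilon> * ?W2)"
      by (simp add: algebra_simps)
    also have "\<dots> = ?x * ?y * (Z (int p * int x) (int p * int y) - Z (int p * int y) (int p * int x))"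
      unfolding Seq Req W2 Z_def by (simp add: algebra_simps)
    also have "\<dots> = int p * (?x * ?y * W' (int x) (int y))"
      unfolding G(2) W'_def by (simp add: algebra_simps)
    finally show ?thesis .
  qed
  ultimately show ?thesis by (intro exI conjI allI)
qed

section \<open>Induction over the digits\<close>

text \<open>Exchanging \<open>a\<close> and \<open>b\<close> gives the number with the complementary
  digit pattern, so one definition serves both arguments of the weight.\<close>

definition digit_sum :: "nat \<Rightarrow> nat \<Rightarrow> nat \<Rightarrow> nat \<Rightarrow> nat \<Rightarrow> nat" where
  "digit_sum p a b n r = (\<Sum>j<n. (if bit r j then b else a) * p ^ j)"

lemma digit_sum_Suc_even: "digit_sum p a b (Suc n) (2 * r) = p * digit_sum p a b n r + a"
  by (simp add: digit_sum_def sum.lessThan_Suc_shift bit_Suc bit_0 sum_distrib_left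
      mult.left_commute del: sum.lessThan_Suc)

lemma digit_sum_Suc_odd: "digit_sum p a b (Suc n) (2 * r + 1) = p * digit_sum p a b n r + b"
  by (simp add: digit_sum_def sum.lessThan_Suc_shift bit_Suc bit_0 sum_distrib_left
      mult.left_commute del: sum.lessThan_Suc)

lemma digit_sum_add:
  "digit_sum p a b (n + m) r = digit_sum p a b n r + p ^ n * digit_sum p a b m (drop_bit n r)"
  by (induction m) (auto simp: digit_sum_def bit_drop_bit_eq algebra_simps power_add)

lemma sum_lessThan_power2_Suc:
  "(\<Sum>r<2 ^ Suc n. f r) = (\<Sum>r<2 ^ n. f (2 * r) + f (2 * r + 1 :: nat))"
  using sum.nat_group[of f 2 "2 ^ n"]
  by (simp add: numeral_2_eq_2 mult.commute add.commute)

lemma prime_power_dvd_cancel_left: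
  assumes "prime p" "\<not> int p dvd u" "int p ^ n dvd u * v"
  shows "int p ^ n dvd v"
proof -
  have "coprime (int p ^ n) u"
    using assms(1,2) by (simp add: prime_imp_coprime)
  then show ?thesis using assms(3) by (simp add: coprime_dvd_mult_right_iff)
qed

text \<open>Induction on \<open>n\<close>, one factor \<open>p\<close> per digit. \<open>K\<close>
  and \<open>W\<close> must vary, since removing the lowest digit replaces them by
  \<open>K div p\<close> and \<open>W'\<close>. \<open>X\<close> and \<open>Y\<close> hold the
  higher digits, which do not depend on \<open>r\<close>.\<close>

lemma prime_power_dvd_antisymmetric_sum:
  assumes "prime p" "a < p" "b < p" "int_poly2 W" "\<And>x y. W y x = - W x y"
  shows "int p ^ n dvd (\<Sum>r<2 ^ n.
    int ((digit_sum p a b n r + p ^ n * X) choose K) * int ((digit_sum p b a n r + p ^ n * Y) choose K)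
      * W (int (digit_sum p a b n r + p ^ n * X)) (int (digit_sum p b a n r + p ^ n * Y)))"
  using assms(4,5)
proof (induction n arbitrary: K W)
  case 0
  show ?case by simp
next
  case (Suc n)
  have sym: "W y x = - 1 * W x y" for x y
    unfolding mult_minus1 by (rule Suc.prems(2))
  obtain u W' where u: "\<not> int p dvd u" and W': "int_poly2 W'" "\<forall>x y. W' y x = - W' x y"
    and eq: "\<forall>x y. u * (int ((p * x + a) choose K) * int ((p * y + b) choose K)
                 * W (int (p * x + a)) (int (p * y + b))
              + 1 * (int ((p * x + b) choose K) * int ((p * y + a) choose K)
                 * W (int (p * x + b)) (int (p * y + a))))
       = int p * (int (x choose (K div p)) * int (y choose (K div p)) * W' (int x) (int y))"
    using binomial_pair_sum_lowest_digit[OF assms(1-3) Suc.prems(1) sym mult_1, of K]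
    by (elim exE conjE) (rule that)
  define x y where "x = (\<lambda>r. digit_sum p a b n r + p ^ n * X)"
    and "y = (\<lambda>r. digit_sum p b a n r + p ^ n * Y)"
  have digits:
    "digit_sum p a b (Suc n) (2 * r) + p ^ Suc n * X = p * x r + a"
    "digit_sum p b a (Suc n) (2 * r) + p ^ Suc n * Y = p * y r + b"
    "digit_sum p a b (Suc n) (2 * r + 1) + p ^ Suc n * X = p * x r + b"
    "digit_sum p b a (Suc n) (2 * r + 1) + p ^ Suc n * Y = p * y r + a" for r
    unfolding digit_sum_Suc_even digit_sum_Suc_odd x_def y_def by (simp_all add: algebra_simps)
  have total: "u * (\<Sum>r<2 ^ Suc n.
        int ((digit_sum p a b (Suc n) r + p ^ Suc n * X) choose K)
        * int ((digit_sum p b a (Suc n) r + p ^ Suc n * Y) choose K)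
        * W (int (digit_sum p a b (Suc n) r + p ^ Suc n * X))
            (int (digit_sum p b a (Suc n) r + p ^ Suc n * Y)))
      = int p * (\<Sum>r<2 ^ n. int (x r choose (K div p)) * int (y r choose (K div p))
          * W' (int (x r)) (int (y r)))"
    unfolding sum_lessThan_power2_Suc digits sum_distrib_left using eq
    by (intro sum.cong refl) (simp only: mult_1)
  have "int p ^ Suc n dvd \<dots>"
    using Suc.IH[OF W'(1) W'(2)[rule_format]] unfolding x_def y_def by (simp add: mult_dvd_mono)
  then show ?case
    unfolding total[symmetric] by (rule prime_power_dvd_cancel_left[OF assms(1) u])
qed

text \<open>The sign depends only on the lowest bit of \<open>r\<close>. Summing over that bit gives
  one factor \<open>p\<close> and leaves an antisymmetric weight for the other \<open>n - 1\<close>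
  digits.\<close>

lemma prime_power_dvd_alternating_sum:
  assumes "prime p" "a < p" "b < p" "n > 0"
  shows "int p ^ n dvd (\<Sum>r<2 ^ n. (- 1) ^ r *
    (int ((digit_sum p a b n r + p ^ n * X) choose K)
      * int ((digit_sum p b a n r + p ^ n * Y) choose K)))"
proof -
  obtain m where n: "n = Suc m" using assms(4) by (cases n) auto
  \<comment> \<open>The constant weight \<open>1\<close> is symmetric, so the digit step applies
    with \<epsilon> equal to \<open>-1\<close>.\<close>
  have sym: "(1 :: int) = - (- 1) * 1" and unit: "(- 1 :: int) * (- 1) = 1" by simp_all
  obtain u W' where u: "\<not> int p dvd u" and W': "int_poly2 W'" "\<forall>x y. W' y x = - W' x y"
    and eq: "\<forall>x y. u * (int ((p * x + a) choose K) * int ((p * y + b) choose K) * 1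
              + (- 1) * (int ((p * x + b) choose K) * int ((p * y + a) choose K) * 1))
       = int p * (int (x choose (K div p)) * int (y choose (K div p)) * W' (int x) (int y))"
    using binomial_pair_sum_lowest_digit[OF assms(1-3) int_poly2.const[of 1] sym unit, of K]
    by (elim exE conjE) (rule that)
  define x y where "x = (\<lambda>r. digit_sum p a b m r + p ^ m * X)"
    and "y = (\<lambda>r. digit_sum p b a m r + p ^ m * Y)"
  have digits:
    "digit_sum p a b (Suc m) (2 * r) + p ^ Suc m * X = p * x r + a"
    "digit_sum p b a (Suc m) (2 * r) + p ^ Suc m * Y = p * y r + b"
    "digit_sum p a b (Suc m) (2 * r + 1) + p ^ Suc m * X = p * x r + b"
    "digit_sum p b a (Suc m) (2 * r + 1) + p ^ Suc m * Y = p * y r + a" for r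
    unfolding digit_sum_Suc_even digit_sum_Suc_odd x_def y_def by (simp_all add: algebra_simps)
  have sign: "(- 1 :: int) ^ (2 * r) = 1" "(- 1 :: int) ^ (2 * r + 1) = - 1" for r :: nat
    by simp_all
  have total: "u * (\<Sum>r<2 ^ Suc m. (- 1) ^ r *
        (int ((digit_sum p a b (Suc m) r + p ^ Suc m * X) choose K)
        * int ((digit_sum p b a (Suc m) r + p ^ Suc m * Y) choose K)))
      = int p * (\<Sum>r<2 ^ m. int (x r choose (K div p)) * int (y r choose (K div p))
          * W' (int (x r)) (int (y r)))"
    unfolding sum_lessThan_power2_Suc digits sign sum_distrib_left using eq
    by (intro sum.cong refl) (simp only: mult_1 mult_1_right)
  have "int p ^ Suc m dvd \<dots>"
    using prime_power_dvd_antisymmetric_sum[OF assms(1-3) W'(1) W'(2)[rule_format]] unfolding x_def y_def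
    by (simp add: mult_dvd_mono)
  then show ?thesis
    unfolding n total[symmetric] by (rule prime_power_dvd_cancel_left[OF assms(1) u])
qed

section \<open>Vandermonde expansion of the summand\<close>

text \<open>Trinomial revision extracts \<open>m choose i\<close> from each term, and Vandermonde
  sums the rest. The bound \<open>N\<close> replaces \<open>m\<close> so that the range of summation
  can be the same for all \<open>r\<close>.\<close>

lemma binomial_product_expansion:
  fixes m B i N :: nat
  assumes "m \<le> N"
  shows "(m choose i) * ((m + B - i) choose m)
    = (\<Sum>k\<le>N. (k choose i) * ((m choose k) * (B choose k)))"
proof (cases "i \<le> m")
  case True
  have "(\<Sum>k\<le>N. (k choose i) * ((m choose k) * (B choose k)))
      = (\<Sum>k\<le>m. (k choose i) * ((m choose k) * (B choose k)))"
    using assms by (intro sum.mono_neutral_right) (auto simp: binomial_eq_0)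
  also have "\<dots> = (\<Sum>k\<le>m. (m choose i) * ((B choose k) * ((m - i) choose (m - k))))"
  proof (rule sum.cong)
    fix k assume "k \<in> {..m}"
    then have km: "k \<le> m" by simp
    show "(k choose i) * ((m choose k) * (B choose k))
        = (m choose i) * ((B choose k) * ((m - i) choose (m - k)))"
    proof (cases "i \<le> k")
      case True
      have "(m choose k) * (k choose i) = (m choose i) * ((m - i) choose (k - i))"
        using choose_mult[OF True km] .
      also have "(m - i) choose (k - i) = (m - i) choose (m - k)"
        using binomial_symmetric[of "k - i" "m - i"] True km by simp
      finally show ?thesis by (simp add: mult_ac)
    \<comment> \<open>For \<open>k < i\<close> the right side vanishes as well, because
      \<open>m - k\<close> exceeds \<open>m - i\<close>.\<close>
    qed (use km True in \<open>simp add: binomial_eq_0 diff_less_mono2\<close>)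
  qed simp
  also have "\<dots> = (m choose i) * ((B + (m - i)) choose m)"
    by (simp only: vandermonde flip: sum_distrib_left)
  finally show ?thesis using True by (simp add: add.commute)
next
  case False
  have "(k choose i) * ((m choose k) * (B choose k)) = 0" for k
    using False by (cases "k \<le> m") (auto simp: binomial_eq_0)
  then show ?thesis using False by (simp add: binomial_eq_0)
qed

lemma zchoose_of_nat: "int m zchoose k = int (m choose k)"
proof -
  have "(of_int (int m zchoose k) :: rat) = of_int (int (m choose k))"
    by (simp add: of_int_zchoose binomial_gbinomial)
  then show ?thesis by (simp only: of_int_eq_iff)
qed

lemma zchoose_product_expansion:
  assumes "m \<le> N"
  shows "(int m zchoose i) * ((int (m + B) - int i) zchoose m)
    = (\<Sum>k\<le>N. int (k choose i) * (int (m choose k) * int (B choose k)))"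
proof (cases "i \<le> m")
  case True
  then have "int (m + B) - int i = int (m + B - i)" by simp
  then show ?thesis
    using binomial_product_expansion[OF assms, of i B]
    by (simp only: zchoose_of_nat flip: of_nat_mult of_nat_sum)
next
  case False
  \<comment> \<open>Here \<open>m + B - i\<close> may be negative, where integer and natural
    subtraction disagree, but the factor \<open>int m zchoose i\<close> is zero.\<close>
  then show ?thesis
    using binomial_product_expansion[OF assms, of i B]
    by (simp add: zchoose_of_nat binomial_eq_0 flip: of_nat_mult of_nat_sum)
qed

section \<open>Truncated expansions and the congruence\<close>

lemma digit_sum_le: "digit_sum p a b n r \<le> (\<Sum>j<n. (a + b) * p ^ j)"
  unfolding digit_sum_def by (intro sum_mono) auto

text \<open>Each position carries \<open>a\<close> in one number and \<open>b\<close> in the other,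
  whatever the bit, so the total is independent of \<open>r\<close>.\<close>

lemma digit_sum_complement:
  "digit_sum p a b n r + digit_sum p b a n r = (\<Sum>j<n. (a + b) * p ^ j)"
  unfolding digit_sum_def sum.distrib[symmetric] by (intro sum.cong) (auto simp: algebra_simps)

lemma k_trunc_eq_digit_sum: "k_trunc p (2 * int a) (2 * int b) s r = 2 * int (digit_sum p a b s r)"
  unfolding k_trunc_def digit_sum_def
  by (simp add: sum_distrib_left) (intro sum.cong, auto simp: algebra_simps)

lemma alpha_trunc_eq_sum:
  "alpha_trunc p (2 * int a) (2 * int b) t = int (\<Sum>j<t. (a + b) * p ^ j)"
proof -
  have "(2 * int a + 2 * int b) div 2 = int (a + b)" by simp
  then show ?thesis by (simp only: alpha_trunc_def of_nat_sum of_nat_mult of_nat_power)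
qed

theorem corollary2p6:
  fixes p n s t i :: nat and a b :: int
  assumes "prime p" and "p > 2" and "n > 0"
    and "even a" and "even b" and "0 \<le> a" and "a < b" and "b \<le> int p - 1"
    and "s > 0" and "t > 0" and "n \<le> s" and "s \<le> t"
  shows "[(\<Sum>r = 0..2 ^ n - 1.
            (- 1) ^ r * ((k_trunc p a b s r div 2) zchoose i)
              * ((alpha_trunc p a b t - int i) zchoose nat (k_trunc p a b s r div 2)))
          = 0] (mod int p ^ n)"
proof -
  define c d where "c = nat (a div 2)" and "d = nat (b div 2)"
  have a: "a = 2 * int c" and b: "b = 2 * int d"
    using assms(4-7) by (simp_all add: c_def d_def)
  have cd: "c < p" "d < p" using assms(6-8) a b by linarith+
  \<comment> \<open>For \<open>r < 2 ^ n\<close> all bits from \<open>n\<close> on are zero, so the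
    upper digits are those of \<open>0\<close>. \<open>Y\<close> also contains the digits
    \<open>c + d\<close> of \<open>alpha_trunc\<close> at the positions from \<open>s\<close> to
    \<open>t - 1\<close>.\<close>
  define X where "X = digit_sum p c d (s - n) 0"
  define Y where "Y = digit_sum p d c (s - n) 0 + p ^ (s - n) * (\<Sum>j<t - s. (c + d) * p ^ j)"
  define x where "x = (\<lambda>r. digit_sum p c d n r + p ^ n * X)"
  define y where "y = (\<lambda>r. digit_sum p d c n r + p ^ n * Y)"
  define N where "N = (\<Sum>j<s. (c + d) * p ^ j)"
  have x: "digit_sum p c d s r = x r" if "r < 2 ^ n" for r
    using digit_sum_add[of p c d n "s - n" r] that assms(11)
    by (simp add: x_def X_def drop_bit_eq_div)
  have xy: "(\<Sum>j<t. (c + d) * p ^ j) = x r + y r" if "r < 2 ^ n" for r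
  proof -
    have "(\<Sum>j<t. (c + d) * p ^ j) = (\<Sum>j<s. (c + d) * p ^ j) + p ^ s * (\<Sum>j<t - s. (c + d) * p ^ j)"
      using digit_sum_add[of p "c + d" "c + d" s "t - s" 0] assms(12) by (simp add: digit_sum_def)
    also have "(\<Sum>j<s. (c + d) * p ^ j) = digit_sum p c d s r + digit_sum p d c s r"
      by (rule digit_sum_complement[symmetric])
    also have "digit_sum p d c s r = digit_sum p d c n r + p ^ n * digit_sum p d c (s - n) 0"
      using digit_sum_add[of p d c n "s - n" r] that assms(11) by (simp add: drop_bit_eq_div)
    also have "p ^ s = p ^ n * p ^ (s - n)"
      using assms(11) by (simp flip: power_add)
    finally show ?thesis
      using x[OF that] by (simp add: y_def Y_def algebra_simps)
  qed
  have "(\<Sum>r = 0..2 ^ n - 1. (- 1) ^ r * ((k_trunc p a b s r div 2) zchoose i)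
          * ((alpha_trunc p a b t - int i) zchoose nat (k_trunc p a b s r div 2)))
      = (\<Sum>r<2 ^ n. \<Sum>k\<le>N. int (k choose i) * ((- 1) ^ r * (int (x r choose k) * int (y r choose k))))"
  proof (rule sum.cong)
    show "{0..2 ^ n - 1} = {..<2 ^ n :: nat}"
      by (metis atLeast0AtMost lessThan_Suc_atMost Suc_pred' pos2 zero_less_power)
  next
    fix r :: nat assume "r \<in> {..<2 ^ n}"
    then have r: "r < 2 ^ n" by simp
    have "x r \<le> N" using digit_sum_le[of p c d s r] x[OF r] by (simp add: N_def)
    from zchoose_product_expansion[OF this, of i "y r"]
    show "(- 1) ^ r * ((k_trunc p a b s r div 2) zchoose i)
          * ((alpha_trunc p a b t - int i) zchoose nat (k_trunc p a b s r div 2))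
        = (\<Sum>k\<le>N. int (k choose i) * ((- 1) ^ r * (int (x r choose k) * int (y r choose k))))"
      unfolding a b k_trunc_eq_digit_sum alpha_trunc_eq_sum xy[OF r] x[OF r]
      by (simp add: mult.assoc sum_distrib_left mult.left_commute del: of_nat_add)
  qed
  \<comment> \<open>The coefficient \<open>k choose i\<close> is free of \<open>r\<close>, so it
    suffices that each inner alternating sum is divisible by \<open>p ^ n\<close>.\<close>
  also have "\<dots> = (\<Sum>k\<le>N. int (k choose i) *
      (\<Sum>r<2 ^ n. (- 1) ^ r * (int (x r choose k) * int (y r choose k))))"
    by (subst sum.swap) (simp add: sum_distrib_left)
  also have "int p ^ n dvd \<dots>"
    unfolding x_def y_def
    by (intro dvd_sum dvd_mult prime_power_dvd_alternating_sum assms cd)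
  finally show ?thesis by (simp add: cong_0_iff)
qed

end
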